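(* Let $n,k$ be positive integers such that $k = mn+\varepsilon$ for some $m \in \mathbb{N}$ and some $\varepsilon \in \{-2,-1,0,1,2\}$. Then for every $(u,v) \in A_{n,k}$ there exists a permutation $\iota$ of $[n]\times[k]$ with $\iota^2 = \mathrm{id}$ such that $[u\circ\iota, v] = W_{[n],[k]}$, i.e. such that for every $(x,y)\in[n]\times[k]$ there is exactly one $e\in[n]\times[k]$ with $u(\iota(e)) = x$ and $v(e)=y$.
   Context: $[n]=\{1,\dots,n\}$ and $\mathbb{N}=\{1,2,\dots\}$. A bipartite labeled multigraph is a tuple $(L,R,E,u,v)$ with $L,R,E$ finite sets (left part, right part, edge set) and functions $u:E\to L$, $v:E\to R$; it is biregular if all vertices of $L$ have the same degree (i.e. $|u^{-1}(x)|$ does not depend on $x\in L$) and all vertices of $R$ have the same degree (i.e. $|v^{-1}(y)|$ does not depend on $y\in R$). $A_{n,k}$ is the set of all biregular bipartite labeled multigraphs with $L=[n]$, $R=[k]$, $E=[n]\times[k]$, written as pairs $(u,v)$; thus $u:[n]\times[k]\to[n]$ has all fibers of size $k$ and $v:[n]\times[k]\to[k]$ has all fibers of size $n$, and $u,v$ are otherwise arbitrary. For functions $u:E\to L$, $v:E\to R$, $[u,v]$ denotes the $L\times R$ matrix whose $(x,y)$ entry is $|\{e\in E : u(e)=x,\ v(e)=y\}|$. $W_{L,R}$ is the $L\times R$ matrix with all entries equal to $1$. *)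

theory Defs
  imports "HOL-Library.FuncSet" "HOL-Combinatorics.Permutations"
begin

definition bip_multigraph ::
  "'l set \<Rightarrow> 'r set \<Rightarrow> 'e set \<Rightarrow> ('e \<Rightarrow> 'l) \<Rightarrow> ('e \<Rightarrow> 'r) \<Rightarrow> bool" where
  "bip_multigraph L R E u v \<longleftrightarrow>
     finite L \<and> finite R \<and> finite E \<and> u \<in> E \<rightarrow> L \<and> v \<in> E \<rightarrow> R"

definition fiber_size :: "'e set \<Rightarrow> ('e \<Rightarrow> 'a) \<Rightarrow> 'a \<Rightarrow> nat" where
  "fiber_size E f x = card {e \<in> E. f e = x}"

definition biregular ::
  "'l set \<Rightarrow> 'r set \<Rightarrow> 'e set \<Rightarrow> ('e \<Rightarrow> 'l) \<Rightarrow> ('e \<Rightarrow> 'r) \<Rightarrow> bool" where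
  "biregular L R E u v \<longleftrightarrow> bip_multigraph L R E u v \<and>
     (\<forall>x\<in>L. \<forall>x'\<in>L. fiber_size E u x = fiber_size E u x') \<and>
     (\<forall>y\<in>R. \<forall>y'\<in>R. fiber_size E v y = fiber_size E v y')"

(* Values of u and v outside the edge set are unconstrained and irrelevant. *)
definition A :: "nat \<Rightarrow> nat \<Rightarrow> ((nat \<times> nat \<Rightarrow> nat) \<times> (nat \<times> nat \<Rightarrow> nat)) set" where
  "A n k = {(u, v). biregular {1..n} {1..k} ({1..n} \<times> {1..k}) u v}"

(* An L x R matrix is a function on pairs that is extensional on L x R
   (undefined elsewhere), so HOL equality is equality of L x R matrices. *)
definition edge_matrix ::
  "'l set \<Rightarrow> 'r set \<Rightarrow> 'e set \<Rightarrow> ('e \<Rightarrow> 'l) \<Rightarrow> ('e \<Rightarrow> 'r) \<Rightarrow> 'l \<times> 'r \<Rightarrow> nat" where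
  "edge_matrix L R E u v =
     restrict (\<lambda>(x, y). card {e \<in> E. u e = x \<and> v e = y}) (L \<times> R)"

definition W :: "'l set \<Rightarrow> 'r set \<Rightarrow> 'l \<times> 'r \<Rightarrow> nat" where
  "W L R = restrict (\<lambda>_. 1) (L \<times> R)"

end

theory Submission imports Defs begin

text \<open>
  Suppose the edges carry a second left label \<open>d : E \<rightarrow> L\<close>, to be thought of as an edge
  colouring whose colours are the left vertices, such that every right vertex sees every colour
  exactly once, and such that for all \<open>x, x'\<close> as many edges at \<open>x\<close> have colour \<open>x'\<close> as edges at
  \<open>x'\<close> have colour \<open>x\<close>. Then the edges with \<open>(u, d) = (x, x')\<close> can be matched with those with
  \<open>(u, d) = (x', x)\<close>; the involution \<open>\<iota>\<close> that exchanges matched edges satisfies \<open>u \<circ> \<iota> = d\<close>,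
  and the first property of \<open>d\<close> says that \<open>[d, v]\<close> has all entries \<open>1\<close>. So all that is needed
  is a proper colouring with a symmetric matrix \<open>[u, d]\<close> (\<open>symmetric_proper_colouring\<close>).

  Every bipartite multigraph has, for any number of colours, an edge colouring in which the sizes
  of two colour classes at a vertex differ by at most one (\<open>even_edge_colouring\<close>). With \<open>n\<close>
  colours, a right vertex, of degree \<open>n\<close>, sees each colour exactly once, and a left vertex, of
  degree \<open>k = m n + \<epsilon>\<close> with \<open>\<bar>\<epsilon>\<bar> \<le> n\<close>, sees each colour \<open>m\<close> times, except for \<open>\<bar>\<epsilon>\<bar>\<close> colours
  that it sees \<open>m + sgn \<epsilon>\<close> times. Hence \<open>[u, d] = m W + sgn \<epsilon> \<cdot> S\<close>, where \<open>S\<close> is a 0-1 matrix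
  with all row and column sums equal to \<open>\<bar>\<epsilon>\<bar> \<le> 2\<close>. The support of such an \<open>S\<close> is empty or the
  union of the graphs of two permutations \<open>\<alpha>, \<beta>\<close> of \<open>L\<close>. Renaming the colours by \<open>\<rho>\<close> replaces
  them by \<open>\<rho> \<circ> \<alpha>\<close> and \<open>\<rho> \<circ> \<beta>\<close>, and since the permutation \<open>\<alpha>\<^sup>-\<^sup>1 \<circ> \<beta>\<close> is a product of two
  involutions, \<open>\<rho>\<close> can be chosen to make both of these involutions; then \<open>S\<close> is symmetric
  (\<open>symmetrizing_relabelling\<close>). This is where \<open>\<bar>\<epsilon>\<bar> \<le> 2\<close> is essential. It also
  gives \<open>\<bar>\<epsilon>\<bar> \<le> n\<close>, unless \<open>n = 1\<close>, where \<open>k = k \<cdot> 1 + 0\<close> can be used instead.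

  The even colouring minimizes the sum of the squares of the sizes of the colour classes over all
  vertices. If two colours were unbalanced at some vertex, the edges of these colours could be
  redistributed as evenly as possible between the two (\<open>two_colouring\<close>), which would
  lower the sum. For the redistribution, pair up the edges at each left vertex and, independently,
  at each right vertex, leaving out at most one edge per vertex. The union of the two pairings is
  a disjoint union of paths and even cycles, so the edges can be coloured such that paired edges
  have different colours.
\<close>

section \<open>Two-colourings alternating along two pairings\<close>

text \<open>Fixed points are allowed, so that an involution encodes a partial pairing.\<close>

definition involution_on :: "'a set \<Rightarrow> ('a \<Rightarrow> 'a) \<Rightarrow> bool" where
  "involution_on E s \<longleftrightarrow> (\<forall>e\<in>E. s e \<in> E \<and> s (s e) = e)"

definition alternates :: "'a set \<Rightarrow> ('a \<Rightarrow> 'a) \<Rightarrow> ('a \<Rightarrow> bool) \<Rightarrow> bool" where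
  "alternates E s f \<longleftrightarrow> (\<forall>e\<in>E. s e \<noteq> e \<longrightarrow> f (s e) \<noteq> f e)"

lemma involution_on_diff_pair:
  assumes "involution_on E s" "e \<in> E"
  shows "involution_on (E - {e, s e}) s"
  using assms unfolding involution_on_def by (metis Diff_iff insert_iff empty_iff)

text \<open>
  Contraction of an \<open>s\<close>-pair \<open>{e, s e}\<close>: delete both edges and make their \<open>t\<close>-partners \<open>a\<close> and
  \<open>b\<close> partners of each other. A colouring of the smaller set gives \<open>a\<close> and \<open>b\<close> different colours,
  and hence extends along the path \<open>a, e, s e, b\<close>.
\<close>
lemma alternating_step:
  assumes IH: "\<And>t'. involution_on (E - {e, s e}) t' \<Longrightarrow>
                 \<exists>f. alternates (E - {e, s e}) s f \<and> alternates (E - {e, s e}) t' f"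
    and s: "involution_on E s" and t: "involution_on E t"
    and e: "e \<in> E" "s e \<noteq> e"
  shows "\<exists>f. alternates E s f \<and> alternates E t f"
proof -
  define e' a b where "e' = s e" and "a = t e" and "b = t e'"
  have mem: "e' \<in> E" "a \<in> E" "b \<in> E"
    using s t e by (auto simp: involution_on_def e'_def a_def b_def)
  have ret: "s e' = e" "t a = e" "t b = e'" "e' \<noteq> e"
    using s t e mem by (auto simp: involution_on_def e'_def a_def b_def)
  have inj: "t x = t y \<longleftrightarrow> x = y" if "x \<in> E" "y \<in> E" for x y
    using t that unfolding involution_on_def by metis
  have ab: "a \<noteq> b" using inj e(1) mem ret by (auto simp: a_def b_def)
  have ae: "a = e' \<longleftrightarrow> b = e" using ret by (auto simp: a_def b_def)
  have else_t: "t z \<in> E - {e, e', a, b}" "t (t z) = z" if "z \<in> E - {e, e', a, b}" for z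
    using t that ret unfolding involution_on_def a_def b_def by auto
  \<comment> \<open>If one of the deleted edges has no \<open>t\<close>-partner, the partner of the other one becomes
      unpaired.\<close>
  define t' where "t' = (\<lambda>z. if z = a then (if b = e' then a else b)
                       else if z = b then (if a = e then b else a) else t z)"
  have inv': "involution_on (E - {e, e'}) t'"
    unfolding involution_on_def
  proof (intro ballI conjI)
    fix z assume z: "z \<in> E - {e, e'}"
    consider "z = a" | "z = b" | "z \<in> E - {e, e', a, b}" using z by blast
    then have "t' z \<in> E - {e, e'} \<and> t' (t' z) = z"
    proof cases
      case 1
      then show ?thesis using z mem ab ae by (auto simp: t'_def)
    next
      case 2
      then show ?thesis using z mem ab ae by (auto simp: t'_def)
    next
      case 3
      then show ?thesis using else_t[OF 3] by (auto simp: t'_def)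
    qed
    then show "t' z \<in> E - {e, e'}" "t' (t' z) = z" by blast+
  qed
  then obtain f where f: "alternates (E - {e, e'}) s f" "alternates (E - {e, e'}) t' f"
    using IH unfolding e'_def by blast
  \<comment> \<open>The colour of \<open>e\<close>. In the last branch \<open>e\<close> has no \<open>t\<close>-partner; there \<open>f b\<close> is an arbitrary
      value if \<open>b = e'\<close>, but then \<open>e'\<close> has no \<open>t\<close>-partner either.\<close>
  define h where "h = (if a = e' then True else if a \<noteq> e then \<not> f a else f b)"
  define g where "g = f(e := h, e' := \<not> h)"
  have "alternates E s g"
    unfolding alternates_def
  proof (intro ballI impI)
    fix z assume z: "z \<in> E" "s z \<noteq> z"
    show "g (s z) \<noteq> g z"
    proof (cases "z = e \<or> z = e'")
      case True
      then show ?thesis using ret by (auto simp: g_def e'_def[symmetric])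
    next
      case False
      then have "s z \<noteq> e" "s z \<noteq> e'"
        using s z e mem ret unfolding involution_on_def e'_def by metis+
      then show ?thesis using False z f(1) by (auto simp: g_def alternates_def)
    qed
  qed
  moreover have "alternates E t g"
    unfolding alternates_def
  proof (intro ballI impI)
    fix z assume z: "z \<in> E" "t z \<noteq> z"
    have fab: "f a \<noteq> f b" if "a \<noteq> e" "a \<noteq> e'" "b \<noteq> e'"
    proof -
      have "a \<in> E - {e, e'}" "t' a = b" using that mem by (auto simp: t'_def)
      then show ?thesis using f(2) ab unfolding alternates_def by metis
    qed
    consider "z = e" | "z = e'" | "z = a" "z \<notin> {e, e'}" | "z = b" "z \<notin> {e, e'}"
      | "z \<notin> {e, e', a, b}" by auto
    then show "g (t z) \<noteq> g z"
    proof cases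
      case 1
      then show ?thesis using z ret by (auto simp: g_def h_def a_def[symmetric])
    next
      case 2
      then show ?thesis using z ret ae fab by (auto simp: g_def h_def b_def[symmetric])
    next
      case 3
      then show ?thesis using z ret by (auto simp: g_def h_def)
    next
      case 4
      then show ?thesis using z ret ae fab by (auto simp: g_def h_def)
    next
      case 5
      then have "t z \<in> E - {e, e', a, b}" "t' z = t z"
        using else_t[of z] z by (auto simp: t'_def)
      moreover from this have "f (t z) \<noteq> f z"
        using f(2) 5 z unfolding alternates_def by force
      ultimately show ?thesis using 5 by (auto simp: g_def)
    qed
  qed
  ultimately show ?thesis by blast
qed

lemma alternating_colouring:
  assumes "finite E" "involution_on E s" "involution_on E t"
  shows "\<exists>f. alternates E s f \<and> alternates E t f"
  using assms
proof (induction E arbitrary: s t rule: finite_psubset_induct)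
  case (psubset E)
  consider e where "e \<in> E" "s e \<noteq> e" | e where "e \<in> E" "t e \<noteq> e"
    | "\<forall>e\<in>E. s e = e \<and> t e = e" by blast
  then show ?case
  proof cases
    case 1
    have "E - {e, s e} \<subset> E" using 1 by blast
    from psubset.IH[OF this involution_on_diff_pair[OF psubset.prems(1) 1(1)]]
    show ?thesis by (rule alternating_step[OF _ psubset.prems 1])
  next
    case 2
    have "E - {e, t e} \<subset> E" using 2 by blast
    from psubset.IH[OF this involution_on_diff_pair[OF psubset.prems(2) 2(1)]]
    have "\<exists>f. alternates E t f \<and> alternates E s f"
      by (rule alternating_step[OF _ psubset.prems(2,1) 2])
    then show ?thesis by blast
  next
    case 3
    then show ?thesis by (auto simp: alternates_def)
  qed
qed

section \<open>Even edge colourings of bipartite multigraphs\<close>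

lemma pairing_in_fibres:
  assumes "finite E"
  shows "\<exists>s. involution_on E s \<and> (\<forall>e\<in>E. g (s e) = g e) \<and>
           (\<forall>e\<in>E. \<forall>e'\<in>E. s e = e \<and> s e' = e' \<and> g e = g e' \<longrightarrow> e = e')"
  using assms
proof (induction E rule: finite_psubset_induct)
  case (psubset E)
  show ?case
  proof (cases "inj_on g E")
    case True
    then show ?thesis
      by (intro exI[of _ id]) (auto simp: involution_on_def inj_on_def)
  next
    case False
    then obtain a b where ab: "a \<in> E" "b \<in> E" "a \<noteq> b" "g a = g b"
      by (auto simp: inj_on_def)
    then have "E - {a, b} \<subset> E" by auto
    from psubset.IH[OF this] obtain s where
      s: "involution_on (E - {a, b}) s" "\<forall>e\<in>E - {a, b}. g (s e) = g e"
         "\<forall>e\<in>E - {a, b}. \<forall>e'\<in>E - {a, b}. s e = e \<and> s e' = e' \<and> g e = g e' \<longrightarrow> e = e'"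
      by blast
    define s' where "s' = s(a := b, b := a)"
    have "involution_on E s'"
      using s(1) ab by (auto simp: involution_on_def s'_def)
    moreover have "g (s' e) = g e" if "e \<in> E" for e
      using s(2) ab that by (auto simp: s'_def)
    moreover have "e \<in> E - {a, b} \<and> s e = e" if "e \<in> E" "s' e = e" for e
      using ab that by (auto simp: s'_def split: if_splits)
    ultimately show ?thesis using s(3) by metis
  qed
qed

text \<open>
  In a fibre of \<open>g\<close>, the involution maps the non-fixed edges of colour \<open>p\<close> injectively to edges of
  the other colour, and there is at most one fixed edge.
\<close>
lemma alternating_half:
  assumes fin: "finite E" and s: "involution_on E s" "\<forall>e\<in>E. g (s e) = g e"
      "\<forall>e\<in>E. \<forall>e'\<in>E. s e = e \<and> s e' = e' \<and> g e = g e' \<longrightarrow> e = e'"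
    and f: "alternates E s f"
  shows "fiber_size {e \<in> E. g e = x} f p \<le> fiber_size {e \<in> E. g e = x} f (\<not> p) + 1"
proof -
  define T where "T q = {e \<in> {e \<in> E. g e = x}. f e = q}" for q
  define X where "X = {e \<in> T p. s e = e}"
  have finT: "finite (T q)" for q using fin by (auto simp: T_def)
  have "\<forall>e\<in>X. \<forall>e'\<in>X. e = e'"
    using s(3) unfolding X_def T_def by blast
  then have X: "card X \<le> 1"
    using finT[of p] card_le_Suc0_iff_eq[of X] by (auto simp: X_def)
  have "inj_on s (T p - X)"
  proof (rule inj_on_inverseI)
    show "s (s e) = e" if "e \<in> T p - X" for e
      using s(1) that by (auto simp: involution_on_def T_def)
  qed
  moreover have "s ` (T p - X) \<subseteq> T (\<not> p)"
  proof
    fix z assume "z \<in> s ` (T p - X)"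
    then obtain e where "z = s e" "e \<in> E" "g e = x" "f e = p" "s e \<noteq> e"
      by (auto simp: T_def X_def)
    then show "z \<in> T (\<not> p)"
      using s(1,2) f by (auto simp: T_def involution_on_def alternates_def)
  qed
  ultimately have "card (T p - X) \<le> card (T (\<not> p))"
    using finT by (rule card_inj_on_le)
  moreover have "card (T p) = card (T p - X) + card X"
    using card_Diff_subset[of X "T p"] card_mono[of "T p" X] finT[of p]
      finite_subset[of X "T p"] by (auto simp: X_def)
  ultimately show ?thesis using X by (simp add: fiber_size_def T_def)
qed

text \<open>
  The case of two colours of the even colouring theorem below, by an alternating colouring for a
  pairing at the left vertices and one at the right vertices. It is used both to improve a
  colouring and to split a 2-regular relation into two permutations.
\<close>
lemma two_colouring:
  assumes "finite E"
  obtains f :: "'e \<Rightarrow> bool" where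
    "\<And>x p. fiber_size {e \<in> E. u e = x} f p \<le> fiber_size {e \<in> E. u e = x} f (\<not> p) + 1"
    "\<And>y p. fiber_size {e \<in> E. v e = y} f p \<le> fiber_size {e \<in> E. v e = y} f (\<not> p) + 1"
proof -
  obtain s where s: "involution_on E s" "\<forall>e\<in>E. u (s e) = u e"
      "\<forall>e\<in>E. \<forall>e'\<in>E. s e = e \<and> s e' = e' \<and> u e = u e' \<longrightarrow> e = e'"
    using pairing_in_fibres[OF assms, of u] by blast
  obtain t where t: "involution_on E t" "\<forall>e\<in>E. v (t e) = v e"
      "\<forall>e\<in>E. \<forall>e'\<in>E. t e = e \<and> t e' = e' \<and> v e = v e' \<longrightarrow> e = e'"
    using pairing_in_fibres[OF assms, of v] by blast
  obtain f where f: "alternates E s f" "alternates E t f"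
    using alternating_colouring[OF assms s(1) t(1)] by blast
  show thesis
    by (rule that[OF alternating_half[OF assms s f(1)] alternating_half[OF assms t f(2)]])
qed

definition evenly_coloured :: "'c set \<Rightarrow> 'e set \<Rightarrow> ('e \<Rightarrow> 'c) \<Rightarrow> bool" where
  "evenly_coloured C F d \<longleftrightarrow> (\<forall>i\<in>C. \<forall>j\<in>C. fiber_size F d i \<le> fiber_size F d j + 1)"

text \<open>
  Since \<open>2 (a\<^sup>2 + b\<^sup>2) = (a + b)\<^sup>2 + (a - b)\<^sup>2\<close>, for a given sum the squares are smallest when
  the difference is; \<open>a' - b'\<close> and \<open>a - b\<close> have the same parity.
\<close>
lemma squares_of_near_halves:
  fixes a b a' b' :: nat
  assumes "a' + b' = a + b" "a' \<le> b' + 1" "b' \<le> a' + 1"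
  shows "a'^2 + b'^2 \<le> a^2 + b^2"
    and "b + 2 \<le> a \<Longrightarrow> a'^2 + b'^2 < a^2 + b^2"
proof -
  have id: "2 * (int p^2 + int q^2) = (int p + int q)^2 + (int p - int q)^2" for p q
    by (simp add: power2_eq_square algebra_simps)
  have sum: "int a' + int b' = int a + int b" using assms(1) by linarith
  have small: "(int a' - int b')^2 \<le> 1"
    using assms(2,3) by (intro abs_square_le_1[THEN iffD2]) auto
  have "(int a' - int b')^2 \<le> (int a - int b)^2"
  proof (cases "a = b")
    case True
    then have "a' = b'" using assms by presburger
    then show ?thesis using True by simp
  next
    case False
    then have "1 \<le> (int a - int b)^2"
      by (simp add: int_one_le_iff_zero_less)
    then show ?thesis using small by linarith
  qed
  then have "2 * (int a'^2 + int b'^2) \<le> 2 * (int a^2 + int b^2)"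
    unfolding id sum by simp
  then have "int (a'^2 + b'^2) \<le> int (a^2 + b^2)" by simp
  then show "a'^2 + b'^2 \<le> a^2 + b^2" unfolding of_nat_le_iff .
  assume "b + 2 \<le> a"
  then have "(2::int)^2 \<le> (int a - int b)^2" by (intro power_mono) auto
  then have "2 * (int a'^2 + int b'^2) < 2 * (int a^2 + int b^2)"
    unfolding id sum using small by simp
  then have "int (a'^2 + b'^2) < int (a^2 + b^2)" by simp
  then show "a'^2 + b'^2 < a^2 + b^2" unfolding of_nat_less_iff .
qed

text \<open>
  The contribution of one side of the graph, with incidence function \<open>g\<close>, to the potential that
  an even colouring minimizes.
\<close>
definition unevenness :: "'e set \<Rightarrow> ('e \<Rightarrow> 'a) \<Rightarrow> 'c set \<Rightarrow> ('e \<Rightarrow> 'c) \<Rightarrow> nat" where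
  "unevenness E g C d = (\<Sum>x\<in>g ` E. \<Sum>c\<in>C. (fiber_size {e \<in> E. g e = x} d c)\<^sup>2)"

text \<open>
  In a fibre \<open>F\<close>, the edges of colours \<open>i\<close> and \<open>j\<close> are redistributed between these two colours
  according to \<open>f\<close>; all other colour classes keep their sizes.
\<close>
lemma recolour_fibre:
  assumes fin: "finite F" "finite C" and ij: "i \<in> C" "j \<in> C" "i \<noteq> j"
    and f: "\<And>p. fiber_size {e \<in> F. d e \<in> {i, j}} f p \<le> fiber_size {e \<in> F. d e \<in> {i, j}} f (\<not> p) + 1"
    and d': "d' = (\<lambda>e. if d e \<in> {i, j} then if f e then i else j else d e)"
  shows "(\<Sum>c\<in>C. (fiber_size F d' c)\<^sup>2) \<le> (\<Sum>c\<in>C. (fiber_size F d c)\<^sup>2)"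
    and "fiber_size F d j + 2 \<le> fiber_size F d i \<Longrightarrow>
      (\<Sum>c\<in>C. (fiber_size F d' c)\<^sup>2) < (\<Sum>c\<in>C. (fiber_size F d c)\<^sup>2)"
proof -
  let ?G = "{e \<in> F. d e \<in> {i, j}}"
  have split: "(\<Sum>c\<in>C. (fiber_size F h c)\<^sup>2) =
      (\<Sum>c\<in>C - {i, j}. (fiber_size F h c)\<^sup>2) + ((fiber_size F h i)\<^sup>2 + (fiber_size F h j)\<^sup>2)" for h
    using fin ij by (subst sum.subset_diff[of "{i, j}"]) auto
  have "{e \<in> F. d' e = c} = {e \<in> F. d e = c}" if "c \<in> C - {i, j}" for c
    using that by (auto simp: d')
  then have rest: "(\<Sum>c\<in>C - {i, j}. (fiber_size F d' c)\<^sup>2) = (\<Sum>c\<in>C - {i, j}. (fiber_size F d c)\<^sup>2)"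
    by (intro sum.cong refl) (simp add: fiber_size_def)
  have both: "fiber_size F h i + fiber_size F h j = card {e \<in> F. h e \<in> {i, j}}" for h
    unfolding fiber_size_def using fin ij
    by (subst card_Un_disjoint[symmetric]) (auto intro: arg_cong[where f = card])
  have G': "{e \<in> F. d' e \<in> {i, j}} = ?G" by (auto simp: d')
  have new: "fiber_size F d' i = fiber_size ?G f True" "fiber_size F d' j = fiber_size ?G f False"
    unfolding fiber_size_def using ij by (auto simp: d' intro!: arg_cong[where f = card])
  have "fiber_size F d' i + fiber_size F d' j = fiber_size F d i + fiber_size F d j"
    using both[of d] both[of d'] G' by simp
  moreover have "fiber_size F d' i \<le> fiber_size F d' j + 1" "fiber_size F d' j \<le> fiber_size F d' i + 1"
    using f[of True] f[of False] by (simp_all add: new)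
  ultimately show "(\<Sum>c\<in>C. (fiber_size F d' c)\<^sup>2) \<le> (\<Sum>c\<in>C. (fiber_size F d c)\<^sup>2)"
    and "fiber_size F d j + 2 \<le> fiber_size F d i \<Longrightarrow>
      (\<Sum>c\<in>C. (fiber_size F d' c)\<^sup>2) < (\<Sum>c\<in>C. (fiber_size F d c)\<^sup>2)"
    unfolding split rest
    using squares_of_near_halves[of "fiber_size F d' i" "fiber_size F d' j" "fiber_size F d i" "fiber_size F d j"]
    by simp_all
qed

lemma fibre_of_restriction:
  "{e \<in> {e \<in> E. P e}. g e = x} = {e \<in> {e \<in> E. g e = x}. P e}"
  by auto

lemma recolour_unevenness:
  assumes fin: "finite E" "finite C" and ij: "i \<in> C" "j \<in> C" "i \<noteq> j"
    and f: "\<And>x p. fiber_size {e \<in> {e \<in> E. d e \<in> {i, j}}. g e = x} f p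
        \<le> fiber_size {e \<in> {e \<in> E. d e \<in> {i, j}}. g e = x} f (\<not> p) + 1"
    and d': "d' = (\<lambda>e. if d e \<in> {i, j} then if f e then i else j else d e)"
  shows "unevenness E g C d' \<le> unevenness E g C d"
    and "fiber_size {e \<in> E. g e = x} d j + 2 \<le> fiber_size {e \<in> E. g e = x} d i \<Longrightarrow>
      unevenness E g C d' < unevenness E g C d"
proof -
  note f' = f[unfolded fibre_of_restriction]
  have finF: "finite {e \<in> E. g e = x}" for x using fin by simp
  note le = recolour_fibre[OF finF fin(2) ij f' d']
  show "unevenness E g C d' \<le> unevenness E g C d"
    unfolding unevenness_def by (intro sum_mono le(1))
  assume x: "fiber_size {e \<in> E. g e = x} d j + 2 \<le> fiber_size {e \<in> E. g e = x} d i"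
  then have "fiber_size {e \<in> E. g e = x} d i \<noteq> 0" by linarith
  then have "{e \<in> {e \<in> E. g e = x}. d e = i} \<noteq> {}"
    unfolding fiber_size_def by (metis card.empty)
  then have "x \<in> g ` E" by auto
  then show "unevenness E g C d' < unevenness E g C d"
    unfolding unevenness_def using fin(1) le(1) le(2)[OF x]
    by (intro sum_strict_mono_ex1) auto
qed

text \<open>
  In a colouring of least total unevenness no vertex can have two colours whose frequencies differ
  by two or more, because redistributing these two colours with \<open>two_colouring\<close> would lower the
  unevenness on the side of that vertex without raising it on the other.
\<close>
theorem even_edge_colouring:
  assumes fin: "finite E" "finite C" "C \<noteq> {}"
  shows "\<exists>d\<in>E \<rightarrow> C. (\<forall>x. evenly_coloured C {e \<in> E. u e = x} d) \<and>
                    (\<forall>y. evenly_coloured C {e \<in> E. v e = y} d)"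
proof -
  let ?\<Phi> = "\<lambda>d. unevenness E u C d + unevenness E v C d"
  obtain c where "c \<in> C" using fin by auto
  then have "(\<lambda>_. c) \<in> E \<rightarrow> C" by auto
  from ex_has_least_nat[of "\<lambda>d. d \<in> E \<rightarrow> C", where m = ?\<Phi>, OF this] obtain d where d: "d \<in> E \<rightarrow> C" and least: "\<And>d'. d' \<in> E \<rightarrow> C \<Longrightarrow> ?\<Phi> d \<le> ?\<Phi> d'"
    by (elim exE conjE) (rule that, assumption, simp)
  have no_gap: "\<not> (fiber_size {e \<in> E. u e = x} d j + 2 \<le> fiber_size {e \<in> E. u e = x} d i) \<and>
         \<not> (fiber_size {e \<in> E. v e = y} d j + 2 \<le> fiber_size {e \<in> E. v e = y} d i)"
    if ij: "i \<in> C" "j \<in> C" "i \<noteq> j" for i j x y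
  proof -
    have finG: "finite {e \<in> E. d e \<in> {i, j}}" using fin by simp
    obtain f where f: "\<And>x p. fiber_size {e \<in> {e \<in> E. d e \<in> {i, j}}. u e = x} f p
          \<le> fiber_size {e \<in> {e \<in> E. d e \<in> {i, j}}. u e = x} f (\<not> p) + 1"
        "\<And>y p. fiber_size {e \<in> {e \<in> E. d e \<in> {i, j}}. v e = y} f p
          \<le> fiber_size {e \<in> {e \<in> E. d e \<in> {i, j}}. v e = y} f (\<not> p) + 1"
      by (rule two_colouring[OF finG, of u v]) (rule that)
    define d' where "d' = (\<lambda>e. if d e \<in> {i, j} then if f e then i else j else d e)"
    have "d' \<in> E \<rightarrow> C" using d ij by (auto simp: d'_def)
    note min = least[OF this]
    note left = recolour_unevenness[OF fin(1,2) ij f(1) d'_def]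
    note right = recolour_unevenness[OF fin(1,2) ij f(2) d'_def]
    show ?thesis
    proof (intro conjI notI)
      assume "fiber_size {e \<in> E. u e = x} d j + 2 \<le> fiber_size {e \<in> E. u e = x} d i"
      from left(2)[OF this] right(1) min show False by linarith
    next
      assume "fiber_size {e \<in> E. v e = y} d j + 2 \<le> fiber_size {e \<in> E. v e = y} d i"
      from right(2)[OF this] left(1) min show False by linarith
    qed
  qed
  have "fiber_size {e \<in> E. u e = x} d i \<le> fiber_size {e \<in> E. u e = x} d j + 1"
       "fiber_size {e \<in> E. v e = y} d i \<le> fiber_size {e \<in> E. v e = y} d j + 1"
    if "i \<in> C" "j \<in> C" for i j x y
    using no_gap[OF that, of x y] by (cases "i = j"; simp)+
  then show ?thesis
    by (intro bexI[OF _ d]) (simp add: evenly_coloured_def)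
qed


section \<open>Making a regular relation of degree at most two symmetric\<close>

text \<open>
  Every permutation \<open>p\<close> is inverted by an involution \<open>t\<close>: on a cycle, \<open>t\<close> is a reflection, and
  the reflection about a prescribed point \<open>a\<close> fixes \<open>a\<close>. In the induction \<open>a\<close> is cut out of its
  cycle \<open>\<dots>, y, a, z, \<dots>\<close>. In the shorter cycle the composite of \<open>p'\<close> with the reflection about \<open>z\<close>
  is a reflection that exchanges the neighbours \<open>y\<close> and \<open>z\<close>, so it extends to the full
  cycle by fixing \<open>a\<close>. The fixed point is part of the claim because this step needs to
  choose the axis.
\<close>
lemma inverting_involution_fixing:
  assumes "finite S" "p permutes S" "a \<in> S"
  shows "\<exists>t. t permutes S \<and> (\<forall>w. t (t w) = w) \<and> (\<forall>w. t (p (t (p w))) = w) \<and> t a = a"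
  using assms
proof (induction S arbitrary: p a rule: finite_psubset_induct)
  case (psubset S)
  note p = psubset.prems(1) and a = psubset.prems(2)
  have smaller: "S - {a} \<subset> S" using a by blast
  define p' where "p' = Transposition.transpose a (p a) \<circ> p"
  have p': "p' permutes S - {a}"
    using permutes_insert_lemma[of p a "S - {a}"] p a by (simp add: p'_def insert_absorb)
  show ?case
  proof (cases "p a = a")
    case True
    then have pp: "p' = p" by (simp add: p'_def)
    show ?thesis
    proof (cases "S - {a} = {}")
      case True
      then have "p = id" using p' unfolding pp by (simp only: permutes_empty)
      then show ?thesis by (intro exI[of _ id] conjI allI permutes_id) simp_all
    next
      case False
      then obtain b where "b \<in> S - {a}" by blast
      from psubset.IH[OF smaller p' this] obtain t where
        t: "t permutes S - {a}" "\<forall>w. t (t w) = w" "\<forall>w. t (p (t (p w))) = w"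
        unfolding pp by blast
      moreover have "t permutes S" using t(1) by (rule permutes_subset) blast
      moreover have "t a = a" using t(1) by (simp add: permutes_def)
      ultimately show ?thesis by blast
    qed
  next
    case False
    define z where "z = p a"
    have z: "z \<in> S - {a}" using p a False permutes_in_image[OF p] by (simp add: z_def)
    from psubset.IH[OF smaller p' z] obtain t' where t': "t' permutes S - {a}"
      and inv: "\<And>w. t' (t' w) = w" "\<And>w. t' (p' (t' (p' w))) = w" and fix_z: "t' z = z"
      by blast
    define t where "t = t' \<circ> p'"
    have t_perm: "t permutes S - {a}" unfolding t_def by (rule permutes_compose[OF p' t'])
    have ta: "t a = a" using t_perm by (simp add: permutes_def)
    have tt: "t (t w) = w" for w by (simp add: t_def inv)
    have inj: "p w = p w' \<longleftrightarrow> w = w'" for w w' using permutes_inj[OF p] by (simp add: inj_eq)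
    obtain y where y: "p y = a" using permutes_surj[OF p] by (metis surjD)
    have "p' y = z" using y by (simp add: p'_def z_def)
    then have ty: "t y = z" by (simp add: t_def fix_z)
    then have tz: "t z = y" using tt by metis
    have p'_eq: "p' w = p w" if "w \<noteq> a" "w \<noteq> y" for w
    proof -
      have "p w \<noteq> a" "p w \<noteq> p a" using that inj y by metis+
      then show ?thesis by (simp add: p'_def)
    qed
    have rev: "p' (t' (p' w)) = t' w" for w using inv by metis
    have "t (p (t (p w))) = w" for w
    proof -
      consider "w = a" | "w = y" | "w \<noteq> a" "w \<noteq> y" by blast
      then show ?thesis
      proof cases
        case 1
        then show ?thesis using tz y ta by (simp add: z_def)
      next
        case 2
        then show ?thesis using tz y ta by (simp add: z_def)
      next
        case 3
        have "t (p w) \<noteq> a" using 3 y inj ta tt by metis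
        moreover have "t (p w) \<noteq> y" using 3 ty inj tt z_def by metis
        ultimately have "t (p (t (p w))) = t' (p' (p' (t' (p' (p' w)))))"
          using 3 p'_eq by (simp add: t_def)
        also have "\<dots> = w" by (simp add: rev inv)
        finally show ?thesis .
      qed
    qed
    moreover have "t permutes S" using t_perm by (rule permutes_subset) blast
    ultimately show ?thesis using tt ta by blast
  qed
qed

lemma inverting_involution:
  assumes "finite S" "p permutes S"
  shows "\<exists>t. t permutes S \<and> (\<forall>w. t (t w) = w) \<and> (\<forall>w. t (p (t (p w))) = w)"
proof (cases "S = {}")
  case True
  then have "p = id" using assms by simp
  then show ?thesis by (intro exI[of _ id]) (auto simp: permutes_id)
next
  case False
  then obtain a where "a \<in> S" by blast
  from inverting_involution_fixing[OF assms this] show ?thesis by blast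
qed

text \<open>
  If the involution \<open>t\<close> inverts \<open>p = \<alpha>\<^sup>-\<^sup>1 \<circ> \<beta>\<close>, then \<open>t \<circ> p\<close> is an involution as well. With
  \<open>\<rho> = t \<circ> \<alpha>\<^sup>-\<^sup>1\<close> the two relabelled permutations are \<open>\<rho> \<circ> \<alpha> = t\<close> and \<open>\<rho> \<circ> \<beta> = t \<circ> p\<close>, and
  the graph of an involution is symmetric.
\<close>
lemma symmetrizing_relabelling:
  assumes "finite L" and \<alpha>: "\<alpha> permutes L" and \<beta>: "\<beta> permutes L"
  shows "\<exists>\<rho>. \<rho> permutes L \<and>
    (\<forall>x x'. x' = \<rho> (\<alpha> x) \<or> x' = \<rho> (\<beta> x) \<longleftrightarrow> x = \<rho> (\<alpha> x') \<or> x = \<rho> (\<beta> x'))"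
proof -
  define p where "p = inv \<alpha> \<circ> \<beta>"
  have "p permutes L"
    unfolding p_def by (rule permutes_compose[OF \<beta> permutes_inv[OF \<alpha>]])
  then obtain t where t: "t permutes L" and tt: "\<And>w. t (t w) = w" and tp: "\<And>w. t (p (t (p w))) = w"
    using inverting_involution[OF assms(1)] by blast
  define \<rho> where "\<rho> = t \<circ> inv \<alpha>"
  have \<rho>\<alpha>: "\<rho> (\<alpha> x) = t x" and \<rho>\<beta>: "\<rho> (\<beta> x) = t (p x)" for x
    by (simp_all add: \<rho>_def p_def permutes_inverses[OF \<alpha>])
  have "\<rho> permutes L"
    unfolding \<rho>_def by (rule permutes_compose[OF permutes_inv[OF \<alpha>] t])
  then show ?thesis
    unfolding \<rho>\<alpha> \<rho>\<beta> using tt tp by (intro exI[of _ \<rho>]) (metis \<rho>\<alpha> \<rho>\<beta>)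
qed

lemma permutation_of_one_regular_relation:
  assumes "finite L"
    and rows: "\<And>x. x \<in> L \<Longrightarrow> card {c \<in> L. Q x c} = 1"
    and cols: "\<And>c. c \<in> L \<Longrightarrow> card {x \<in> L. Q x c} = 1"
  shows "\<exists>\<alpha>. \<alpha> permutes L \<and> (\<forall>x\<in>L. \<forall>c\<in>L. Q x c \<longleftrightarrow> c = \<alpha> x)"
proof -
  have "\<exists>c. {c \<in> L. Q x c} = {c}" if "x \<in> L" for x
    using rows[OF that] by (simp add: card_1_singleton_iff)
  then obtain a where a: "\<And>x. x \<in> L \<Longrightarrow> {c \<in> L. Q x c} = {a x}" by metis
  have "\<exists>x. {x \<in> L. Q x c} = {x}" if "c \<in> L" for c
    using cols[OF that] by (simp add: card_1_singleton_iff)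
  then obtain b where b: "\<And>c. c \<in> L \<Longrightarrow> {x \<in> L. Q x c} = {b c}" by metis
  have aL: "a x \<in> L" "Q x (a x)" if "x \<in> L" for x using a[OF that] by blast+
  have ba: "b (a x) = x" if "x \<in> L" for x 
  proof -
    have "x \<in> {x' \<in> L. Q x' (a x)}" using aL(2)[OF that] that by simp
    then show ?thesis using b[OF aL(1)[OF that]] by simp
  qed
  define \<alpha> where "\<alpha> x = (if x \<in> L then a x else x)" for x
  have "inj_on \<alpha> L" by (rule inj_on_inverseI[of _ b]) (simp add: \<alpha>_def ba)
  moreover have "\<alpha> ` L \<subseteq> L" using aL by (auto simp: \<alpha>_def)
  ultimately have "bij_betw \<alpha> L L"
    using assms(1) by (simp add: bij_betw_def endo_inj_surj)
  then have "\<alpha> permutes L" by (rule bij_imp_permutes) (simp add: \<alpha>_def)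
  moreover have "Q x c \<longleftrightarrow> c = \<alpha> x" if "x \<in> L" "c \<in> L" for x c
    using a[OF that(1)] that by (auto simp: \<alpha>_def)
  ultimately show ?thesis by blast
qed

text \<open>
  Regard the relation as a bipartite graph. An even two-colouring of its edges gives each vertex,
  having degree \<open>2\<close>, exactly one edge of each colour, so each colour class is a permutation.
\<close>
lemma permutations_of_two_regular_relation:
  assumes fin: "finite L"
    and rows: "\<And>x. x \<in> L \<Longrightarrow> card {c \<in> L. Q x c} = 2"
    and cols: "\<And>c. c \<in> L \<Longrightarrow> card {x \<in> L. Q x c} = 2"
  shows "\<exists>\<alpha> \<beta>. \<alpha> permutes L \<and> \<beta> permutes L \<and>
           (\<forall>x\<in>L. \<forall>c\<in>L. Q x c \<longleftrightarrow> c = \<alpha> x \<or> c = \<beta> x)"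
proof -
  define E where "E = {(x, c). x \<in> L \<and> c \<in> L \<and> Q x c}"
  have "E \<subseteq> L \<times> L" by (auto simp: E_def)
  then have finE: "finite E" using fin by (meson finite_SigmaI finite_subset)
  obtain f where
    f: "\<And>x p. fiber_size {e \<in> E. fst e = x} f p \<le> fiber_size {e \<in> E. fst e = x} f (\<not> p) + 1"
       "\<And>c p. fiber_size {e \<in> E. snd e = c} f p \<le> fiber_size {e \<in> E. snd e = c} f (\<not> p) + 1"
    by (rule two_colouring[OF finE, of fst snd]) (rule that)
  have row: "fiber_size {e \<in> E. fst e = x} f p = card {c \<in> L. Q x c \<and> f (x, c) = p}" if "x \<in> L" for x p
  proof -
    have "{e \<in> {e \<in> E. fst e = x}. f e = p} = Pair x ` {c \<in> L. Q x c \<and> f (x, c) = p}"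
      using that by (auto simp: E_def)
    then show ?thesis by (simp add: fiber_size_def card_image inj_on_def)
  qed
  have col: "fiber_size {e \<in> E. snd e = c} f p = card {x \<in> L. Q x c \<and> f (x, c) = p}" if "c \<in> L" for c p
  proof -
    have "{e \<in> {e \<in> E. snd e = c}. f e = p} = (\<lambda>x. (x, c)) ` {x \<in> L. Q x c \<and> f (x, c) = p}"
      using that by (auto simp: E_def)
    then show ?thesis by (simp add: fiber_size_def card_image inj_on_def)
  qed
  have split: "card {z \<in> L. P z \<and> h z = True} + card {z \<in> L. P z \<and> h z = False} = card {z \<in> L. P z}"
    for P h :: "_ \<Rightarrow> bool"
    using fin by (subst card_Un_disjoint[symmetric]) (auto intro: arg_cong[where f = card])
  have "card {c \<in> L. Q x c \<and> f (x, c) = p} = 1" if "x \<in> L" for x p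
    using f(1)[of x True] f(1)[of x False] split[of "Q x" "\<lambda>c. f (x, c)"] rows[OF that]
    by (cases p) (simp_all add: row[OF that])
  moreover have "card {x \<in> L. Q x c \<and> f (x, c) = p} = 1" if "c \<in> L" for c p
    using f(2)[of c True] f(2)[of c False] split[of "\<lambda>x. Q x c" "\<lambda>x. f (x, c)"] cols[OF that]
    by (cases p) (simp_all add: col[OF that])
  ultimately have "\<exists>\<alpha>. \<alpha> permutes L \<and> (\<forall>x\<in>L. \<forall>c\<in>L. Q x c \<and> f (x, c) = p \<longleftrightarrow> c = \<alpha> x)" for p
    by (intro permutation_of_one_regular_relation[OF fin])
  from this[of True] this[of False] obtain \<alpha> \<beta> where "\<alpha> permutes L" "\<beta> permutes L"
    "\<forall>x\<in>L. \<forall>c\<in>L. Q x c \<and> f (x, c) = True \<longleftrightarrow> c = \<alpha> x"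
    "\<forall>x\<in>L. \<forall>c\<in>L. Q x c \<and> f (x, c) = False \<longleftrightarrow> c = \<beta> x"
    by (elim exE conjE) (rule that)
  moreover from this have "Q x c \<longleftrightarrow> c = \<alpha> x \<or> c = \<beta> x" if "x \<in> L" "c \<in> L" for x c
    using that by (cases "f (x, c)") auto
  ultimately show ?thesis by (intro exI[of _ \<alpha>] exI[of _ \<beta>]) simp
qed

section \<open>Proper colourings with symmetric counts\<close>

lemma sum_fiber_size:
  assumes "finite F" "finite C" "d \<in> F \<rightarrow> C"
  shows "(\<Sum>c\<in>C. fiber_size F d c) = card F"
proof -
  have "(\<Sum>c\<in>C. sum (\<lambda>_. 1::nat) {e \<in> F. d e = c}) = sum (\<lambda>_. 1) F"
    using assms by (intro sum.group) auto
  then show ?thesis by (simp add: fiber_size_def)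
qed

text \<open>
  A value \<open>\<ge> 2\<close> would force all values to be \<open>\<ge> 1\<close> and the sum to exceed \<open>card C\<close>; a negative
  value would force all values to be \<open>\<le> 0\<close> and the sum to be negative.
\<close>
lemma near_constant_zero_one:
  fixes g :: "'c \<Rightarrow> int"
  assumes "finite C" and near: "\<And>i j. i \<in> C \<Longrightarrow> j \<in> C \<Longrightarrow> g i \<le> g j + 1"
    and "0 \<le> sum g C" "sum g C \<le> int (card C)" and c: "c \<in> C"
  shows "g c = 0 \<or> g c = 1"
proof (rule ccontr)
  have split: "sum g C = g c + sum g (C - {c})" using assms(1) c by (rule sum.remove)
  have card: "int (card C) = 1 + int (card (C - {c}))"
    using card.remove[OF assms(1) c] by simp
  assume "\<not> ?thesis"
  then consider "g c \<ge> 2" | "g c < 0" by linarith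
  then show False
  proof cases
    case 1
    then have "sum g (C - {c}) \<ge> (\<Sum>_\<in>C - {c}. 1)"
      using near[OF c] by (intro sum_mono) fastforce
    then show ?thesis using split card 1 assms(4) by simp
  next
    case 2
    then have "sum g (C - {c}) \<le> 0"
      using near[OF _ c] by (intro sum_nonpos) fastforce
    then show ?thesis using split 2 assms(3) by simp
  qed
qed

text \<open>
  The previous lemma is applied to the deviations from \<open>m\<close>, with the sign that makes their sum
  nonnegative. For \<open>\<epsilon> = 0\<close> both signs are possible, which leaves only the deviation \<open>0\<close>.
\<close>
lemma even_colouring_sizes:
  assumes F: "finite F" "finite C" "d \<in> F \<rightarrow> C" and even: "evenly_coloured C F d"
    and card: "int (card F) = int m * int (card C) + \<epsilon>" and small: "\<bar>\<epsilon>\<bar> \<le> int (card C)"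
    and c: "c \<in> C"
  shows "sgn \<epsilon> * (int (fiber_size F d c) - int m) \<in> {0, 1}"
    and "\<epsilon> = 0 \<Longrightarrow> fiber_size F d c = m"
proof -
  define g where "g s c = s * (int (fiber_size F d c) - int m)" for s :: int and c
  have "(\<Sum>c\<in>C. int (fiber_size F d c)) = int (card F)"
    using sum_fiber_size[OF F] by (metis of_nat_sum)
  then have total: "sum (g s) C = s * \<epsilon>" for s
    unfolding g_def sum_distrib_left[symmetric] sum_subtractf using card by (simp add: algebra_simps)
  have near: "g s i \<le> g s j + 1" if "i \<in> C" "j \<in> C" "s \<in> {1, -1}" for s i j
    using even that unfolding evenly_coloured_def g_def by fastforce
  have main: "g s c = 0 \<or> g s c = 1" if "s \<in> {1, -1}" "0 \<le> s * \<epsilon>" for s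
    using near_constant_zero_one[OF F(2) near[OF _ _ that(1)] _ _ c] that total[of s] small by fastforce
  show "sgn \<epsilon> * (int (fiber_size F d c) - int m) \<in> {0, 1}"
    using main[of 1] main[of "-1"] unfolding g_def sgn_if by auto
  assume "\<epsilon> = 0"
  then show "fiber_size F d c = m"
    using main[of 1] main[of "-1"] unfolding g_def by auto
qed

text \<open>
  An even colouring with colour set \<open>L\<close>, after a suitable renaming of the colours. The matrix
  called \<open>S\<close> in the introduction is \<open>g\<close> in the proof.
\<close>
theorem symmetric_proper_colouring:
  fixes u :: "'e \<Rightarrow> 'l" and v :: "'e \<Rightarrow> 'r" and \<epsilon> :: int
  assumes fin: "finite E" "finite L" "finite R" "L \<noteq> {}"
    and uv: "u \<in> E \<rightarrow> L" "v \<in> E \<rightarrow> R"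
    and deg_u: "\<And>x. x \<in> L \<Longrightarrow> fiber_size E u x = card R"
    and deg_v: "\<And>y. y \<in> R \<Longrightarrow> fiber_size E v y = card L"
    and R: "int (card R) = int m * int (card L) + \<epsilon>"
    and \<epsilon>: "\<epsilon> \<in> {-2, -1, 0, 1, 2}" "\<bar>\<epsilon>\<bar> \<le> int (card L)"
  obtains d where "d \<in> E \<rightarrow> L"
    and "\<And>y x. y \<in> R \<Longrightarrow> x \<in> L \<Longrightarrow> card {e \<in> E. d e = x \<and> v e = y} = 1"
    and "\<And>x x'. card {e \<in> E. u e = x \<and> d e = x'} = card {e \<in> E. u e = x' \<and> d e = x}"
proof -
  obtain d where d: "d \<in> E \<rightarrow> L"
    and even_u: "\<forall>x. evenly_coloured L {e \<in> E. u e = x} d"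
    and even_v: "\<forall>y. evenly_coloured L {e \<in> E. v e = y} d"
    using even_edge_colouring[OF fin(1,2,4), of u v] by (elim bexE conjE) (rule that)
  have d_sub: "d \<in> {e \<in> E. P e} \<rightarrow> L" and fin_sub: "finite {e \<in> E. P e}" for P
    using d fin by auto
  have proper: "card {e \<in> E. d e = x \<and> v e = y} = 1" if "y \<in> R" "x \<in> L" for y x
  proof -
    have "fiber_size {e \<in> E. v e = y} d x = 1"
      using even_colouring_sizes(2)[OF fin_sub fin(2) d_sub even_v[rule_format], of y 1 0 x] that deg_v
      by (simp add: fiber_size_def)
    moreover have "{e \<in> {e \<in> E. v e = y}. d e = x} = {e \<in> E. d e = x \<and> v e = y}" by auto
    ultimately show ?thesis by (simp add: fiber_size_def)
  qed
  define N where "N x c = card {e \<in> E. u e = x \<and> d e = c}" for x c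
  have N_row: "fiber_size {e \<in> E. u e = x} d c = N x c" for x c
    by (simp add: fiber_size_def N_def conj_assoc)
  have N_col: "fiber_size {e \<in> E. d e = c} u x = N x c" for x c
    by (auto simp: fiber_size_def N_def intro!: arg_cong[where f = card])
  define g where "g x c = sgn \<epsilon> * (int (N x c) - int m)" for x c
  have g01: "g x c \<in> {0, 1}" and N0: "\<epsilon> = 0 \<Longrightarrow> N x c = m" if "x \<in> L" "c \<in> L" for x c
  proof -
    have "int (card {e \<in> E. u e = x}) = int m * int (card L) + \<epsilon>"
      using deg_u[OF that(1)] R by (simp add: fiber_size_def)
    note even_colouring_sizes[OF fin_sub fin(2) d_sub even_u[rule_format] this \<epsilon>(2) that(2)]
    then show "g x c \<in> {0, 1}" "\<epsilon> = 0 \<Longrightarrow> N x c = m" by (simp_all add: g_def N_row)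
  qed
  \<comment> \<open>Each right vertex sees the colour \<open>c\<close> once, so the colour classes have the same size as the
      fibres of \<open>u\<close>; hence the columns of \<open>g\<close> have the same sum as its rows.\<close>
  have colour_class: "card {e \<in> E. d e = c} = card R" if "c \<in> L" for c
  proof -
    have "card {e \<in> E. d e = c} = (\<Sum>y\<in>R. fiber_size {e \<in> E. d e = c} v y)"
      using uv by (intro sum_fiber_size[symmetric] fin fin_sub) auto
    also have "\<dots> = (\<Sum>y\<in>R. 1)"
      using proper that by (intro sum.cong) (simp_all add: fiber_size_def)
    finally show ?thesis by simp
  qed
  have g_sum: "(\<Sum>z\<in>L. sgn \<epsilon> * (int (h z) - int m)) = \<bar>\<epsilon>\<bar>" if "(\<Sum>z\<in>L. h z) = card R" for h
  proof -
    have "(\<Sum>z\<in>L. int (h z)) = int (card R)" using that by (metis of_nat_sum)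
    then show ?thesis
      unfolding sum_distrib_left[symmetric] sum_subtractf using R by (simp add: algebra_simps abs_sgn)
  qed
  have "(\<Sum>c\<in>L. N x c) = card R" if "x \<in> L" for x
    using sum_fiber_size[OF fin_sub fin(2) d_sub, of "\<lambda>e. u e = x"] deg_u[OF that]
    by (simp add: N_row fiber_size_def[of E])
  then have row: "(\<Sum>c\<in>L. g x c) = \<bar>\<epsilon>\<bar>" if "x \<in> L" for x
    unfolding g_def using g_sum that by blast
  have "(\<Sum>x\<in>L. N x c) = card R" if "c \<in> L" for c
    using sum_fiber_size[OF fin_sub fin(2), of u "\<lambda>e. d e = c"] uv colour_class[OF that]
    by (auto simp: N_col)
  then have col: "(\<Sum>x\<in>L. g x c) = \<bar>\<epsilon>\<bar>" if "c \<in> L" for c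
    unfolding g_def using g_sum that by blast
  have count: "int (card {z \<in> L. h z = 1}) = (\<Sum>z\<in>L. h z)" if "\<And>z. z \<in> L \<Longrightarrow> h z \<in> {0, 1}"
    for h :: "'l \<Rightarrow> int"
  proof -
    have "(\<Sum>z\<in>L. h z) = (\<Sum>z\<in>L. if h z = 1 then 1 else 0)"
      using that by (intro sum.cong) force+
    also have "\<dots> = int (card {z \<in> L. h z = 1})"
      using fin by (simp add: sum.If_cases Int_def)
    finally show ?thesis by simp
  qed
  have rows: "int (card {c \<in> L. g x c = 1}) = \<bar>\<epsilon>\<bar>" if "x \<in> L" for x
    using count[of "g x"] g01[OF that] row[OF that] by simp
  have cols: "int (card {x \<in> L. g x c = 1}) = \<bar>\<epsilon>\<bar>" if "c \<in> L" for c
    using count[of "\<lambda>x. g x c"] g01[OF _ that] col[OF that] by simp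
  have "\<exists>\<rho>. \<rho> permutes L \<and> (\<forall>x\<in>L. \<forall>x'\<in>L. N x (inv \<rho> x') = N x' (inv \<rho> x))"
  proof (cases "\<epsilon> = 0")
    case True
    then show ?thesis using N0 by (intro exI[of _ id]) (simp add: permutes_id)
  next
    case False
    have "\<exists>\<alpha> \<beta>. \<alpha> permutes L \<and> \<beta> permutes L \<and> (\<forall>x\<in>L. \<forall>c\<in>L. g x c = 1 \<longleftrightarrow> c = \<alpha> x \<or> c = \<beta> x)"
    proof (cases "\<bar>\<epsilon>\<bar> = 1")
      case True
      then show ?thesis
        using permutation_of_one_regular_relation[OF fin(2), of "\<lambda>x c. g x c = 1"] rows cols by fastforce
    next
      case two: False
      with False \<epsilon> have "\<bar>\<epsilon>\<bar> = 2" by auto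
      then show ?thesis
        using rows cols by (intro permutations_of_two_regular_relation[OF fin(2)]) force+
    qed
    then obtain \<alpha> \<beta> where perms: "\<alpha> permutes L" "\<beta> permutes L"
      and g_iff: "\<And>x c. x \<in> L \<Longrightarrow> c \<in> L \<Longrightarrow> g x c = 1 \<longleftrightarrow> c = \<alpha> x \<or> c = \<beta> x" by blast
    obtain \<rho> where \<rho>: "\<rho> permutes L"
      and sym: "\<And>x x'. x' = \<rho> (\<alpha> x) \<or> x' = \<rho> (\<beta> x) \<longleftrightarrow> x = \<rho> (\<alpha> x') \<or> x = \<rho> (\<beta> x')"
      using symmetrizing_relabelling[OF fin(2) perms] by blast
    have "N x (inv \<rho> x') = N x' (inv \<rho> x)" if x: "x \<in> L" "x' \<in> L" for x x'
    proof -
      have inv_in: "inv \<rho> y \<in> L" if "y \<in> L" for y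
        using permutes_in_image[OF permutes_inv[OF \<rho>]] that by blast
      have inv_eq: "inv \<rho> y = c \<longleftrightarrow> y = \<rho> c" for y c
        using permutes_inverses[OF \<rho>] by metis
      have "g x (inv \<rho> x') = 1 \<longleftrightarrow> g x' (inv \<rho> x) = 1"
        using sym[of x' x] x by (simp add: g_iff inv_in inv_eq)
      then have "g x (inv \<rho> x') = g x' (inv \<rho> x)"
        using g01[OF x(1) inv_in[OF x(2)]] g01[OF x(2) inv_in[OF x(1)]] by auto
      then show ?thesis using False by (simp add: g_def sgn_0_0)
    qed
    then show ?thesis using \<rho> by blast
  qed
  then obtain \<rho> where \<rho>: "\<rho> permutes L"
    and sym: "\<And>x x'. x \<in> L \<Longrightarrow> x' \<in> L \<Longrightarrow> N x (inv \<rho> x') = N x' (inv \<rho> x)" by blast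
  have relabel: "\<rho> (d e) = x \<longleftrightarrow> d e = inv \<rho> x" for e x
    using permutes_inverses[OF \<rho>] by metis
  show thesis
  proof (rule that[of "\<rho> \<circ> d"])
    show \<rho>d: "\<rho> \<circ> d \<in> E \<rightarrow> L" using d permutes_in_image[OF \<rho>] by auto
    show "card {e \<in> E. (\<rho> \<circ> d) e = x \<and> v e = y} = 1" if "y \<in> R" "x \<in> L" for y x
      using proper[OF that(1), of "inv \<rho> x"] permutes_in_image[OF permutes_inv[OF \<rho>]] that
      by (simp add: relabel)
    show "card {e \<in> E. u e = x \<and> (\<rho> \<circ> d) e = x'} = card {e \<in> E. u e = x' \<and> (\<rho> \<circ> d) e = x}" for x x'
    proof (cases "x \<in> L \<and> x' \<in> L")
      case True
      then show ?thesis using sym[of x x'] by (simp add: relabel N_def)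
    next
      case False
      then have "{e \<in> E. u e = x \<and> (\<rho> \<circ> d) e = x'} = {}" "{e \<in> E. u e = x' \<and> (\<rho> \<circ> d) e = x} = {}"
        using uv \<rho>d by auto
      then show ?thesis by (simp only: )
    qed
  qed
qed

section \<open>From a symmetric colouring to the involution\<close>

text \<open>
  The linear order serves to choose only one of the two mutually inverse bijections between
  the edges with labels \<open>(x, y)\<close> and those with labels \<open>(y, x)\<close>; for \<open>x = y\<close> all edges are fixed.
\<close>
lemma involution_of_symmetric_counts:
  fixes u d :: "'e \<Rightarrow> 'l :: linorder"
  assumes fin: "finite E"
    and sym: "\<And>x y. card {e \<in> E. u e = x \<and> d e = y} = card {e \<in> E. u e = y \<and> d e = x}"
  shows "\<exists>\<iota>. \<iota> permutes E \<and> \<iota> \<circ> \<iota> = id \<and> (\<forall>e\<in>E. u (\<iota> e) = d e)"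
proof -
  define M where "M x y = {e \<in> E. u e = x \<and> d e = y}" for x y
  have "\<exists>b. bij_betw b (M x y) (M y x)" for x y
    using fin sym[of x y] by (intro finite_same_card_bij) (auto simp: M_def)
  then have b: "bij_betw (SOME b. bij_betw b (M x y) (M y x)) (M x y) (M y x)" for x y
    by (rule someI_ex)
  define b where "b x y = (SOME b. bij_betw b (M x y) (M y x))" for x y
  note b = b[folded b_def]
  define g where "g x y = (if x < y then b x y else if x = y then id else inv_into (M y x) (b y x))" for x y
  have g_in: "g x y e \<in> M y x" and g_g: "g y x (g x y e) = e" if "e \<in> M x y" for x y e
  proof -
    have 1: "b x y e \<in> M y x" "inv_into (M x y) (b x y) (b x y e) = e"
      using b[of x y] that by (auto simp: bij_betw_def)
    have 2: "inv_into (M y x) (b y x) e \<in> M y x" "b y x (inv_into (M y x) (b y x) e) = e"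
      using b[of y x] that by (auto simp: bij_betw_def inv_into_into f_inv_into_f)
    have "g x y e \<in> M y x \<and> g y x (g x y e) = e"
    proof (cases x y rule: linorder_cases)
      case less
      then show ?thesis using 1 less by (auto simp: g_def)
    next
      case equal
      then show ?thesis using that by (simp add: g_def)
    next
      case greater
      then show ?thesis using 2 greater by (auto simp: g_def)
    qed
    then show "g x y e \<in> M y x" "g y x (g x y e) = e" by blast+
  qed
  define \<iota> where "\<iota> e = (if e \<in> E then g (u e) (d e) e else e)" for e
  have \<iota>: "\<iota> e \<in> E" "u (\<iota> e) = d e" "\<iota> (\<iota> e) = e" if "e \<in> E" for e
  proof -
    have e: "e \<in> M (u e) (d e)" using that by (simp add: M_def)
    show \<iota>E: "\<iota> e \<in> E" and u\<iota>: "u (\<iota> e) = d e"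
      using g_in[OF e] that by (auto simp: \<iota>_def M_def)
    have "d (\<iota> e) = u e" using g_in[OF e] that by (auto simp: \<iota>_def M_def)
    then have "\<iota> (\<iota> e) = g (d e) (u e) (\<iota> e)" using \<iota>E u\<iota> by (simp add: \<iota>_def[of "\<iota> e"])
    then show "\<iota> (\<iota> e) = e" using g_g[OF e] that by (simp add: \<iota>_def)
  qed
  have inv: "\<iota> (\<iota> e) = e" for e using \<iota>(3) by (cases "e \<in> E") (simp_all add: \<iota>_def)
  have "\<iota> permutes E"
    by (rule bij_imp_permutes[OF bij_betwI[of _ _ _ \<iota>]]) (simp_all add: \<iota>(1) inv, simp add: \<iota>_def)
  moreover have "\<iota> \<circ> \<iota> = id" using inv by (simp add: fun_eq_iff)
  ultimately show ?thesis using \<iota>(2) by blast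
qed

lemma fiber_size_of_equal:
  assumes "finite E" "finite L" "f \<in> E \<rightarrow> L" "card E = card L * q"
    and "\<forall>x\<in>L. \<forall>x'\<in>L. fiber_size E f x = fiber_size E f x'" and "x \<in> L"
  shows "fiber_size E f x = q"
proof -
  have "(\<Sum>z\<in>L. fiber_size E f z) = (\<Sum>z\<in>L. fiber_size E f x)"
    using assms(5,6) by (intro sum.cong refl) blast
  then have "card L * q = card L * fiber_size E f x"
    using sum_fiber_size[OF assms(1-3)] assms(4) by simp
  then show ?thesis using assms(2,6) by auto
qed

theorem theorem2:
  fixes n k m :: nat and \<epsilon> :: int
    and u v :: "nat \<times> nat \<Rightarrow> nat"
  assumes "n \<ge> 1" and "k \<ge> 1" and "m \<ge> 1"
    and "\<epsilon> \<in> {-2, -1, 0, 1, 2}"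
    and "int k = int m * int n + \<epsilon>"
    and "(u, v) \<in> A n k"
  shows "\<exists>\<iota>. \<iota> permutes ({1..n} \<times> {1..k}) \<and> \<iota> \<circ> \<iota> = id \<and>
    edge_matrix {1..n} {1..k} ({1..n} \<times> {1..k}) (u \<circ> \<iota>) v = W {1..n} {1..k}"
proof -
  let ?L = "{1..n}" and ?R = "{1..k}"
  let ?E = "?L \<times> ?R"
  have uv: "u \<in> ?E \<rightarrow> ?L" "v \<in> ?E \<rightarrow> ?R"
    and equal: "\<forall>x\<in>?L. \<forall>x'\<in>?L. fiber_size ?E u x = fiber_size ?E u x'"
      "\<forall>y\<in>?R. \<forall>y'\<in>?R. fiber_size ?E v y = fiber_size ?E v y'"
    using assms(6) unfolding A_def biregular_def bip_multigraph_def mem_Collect_eq split_conv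
    by blast+
  have deg_u: "fiber_size ?E u x = card ?R" if "x \<in> ?L" for x
    by (rule fiber_size_of_equal[OF _ _ uv(1) _ equal(1) that]) (simp_all add: card_cartesian_product)
  have deg_v: "fiber_size ?E v y = card ?L" if "y \<in> ?R" for y
    by (rule fiber_size_of_equal[OF _ _ uv(2) _ equal(2) that]) (simp_all add: card_cartesian_product)
  \<comment> \<open>For \<open>n = 1\<close> the deviation \<open>\<epsilon>\<close> may exceed \<open>n\<close> in absolute value; then \<open>k = k \<cdot> 1 + 0\<close> is the
      representation to use.\<close>
  obtain m' \<epsilon>' where k: "int (card ?R) = int m' * int (card ?L) + \<epsilon>'"
    and \<epsilon>': "\<epsilon>' \<in> {-2, -1, 0, 1, 2}" "\<bar>\<epsilon>'\<bar> \<le> int (card ?L)"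
  proof (cases "n = 1")
    case True
    then show thesis using that[of k 0] by simp
  next
    case False
    then have "\<bar>\<epsilon>\<bar> \<le> int n" using assms(1,4) by auto
    then show thesis using that[of m \<epsilon>] assms(4,5) by simp
  qed
  have fin: "finite ?E" "finite ?L" "finite ?R" and "?L \<noteq> {}"
    using assms(1) by simp_all
  obtain d where d: "d \<in> ?E \<rightarrow> ?L"
    and proper: "\<And>y x. y \<in> ?R \<Longrightarrow> x \<in> ?L \<Longrightarrow> card {e \<in> ?E. d e = x \<and> v e = y} = 1"
    and sym: "\<And>x x'. card {e \<in> ?E. u e = x \<and> d e = x'} = card {e \<in> ?E. u e = x' \<and> d e = x}"
    by (rule symmetric_proper_colouring[OF fin \<open>?L \<noteq> {}\<close> uv deg_u deg_v k \<epsilon>'])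
      (assumption, assumption, rule that)
  obtain \<iota> where \<iota>: "\<iota> permutes ?E" "\<iota> \<circ> \<iota> = id" "\<And>e. e \<in> ?E \<Longrightarrow> u (\<iota> e) = d e"
  proof -
    from involution_of_symmetric_counts[OF fin(1) sym] show thesis
      by (elim exE conjE) (rule that, assumption, assumption, erule bspec)
  qed
  have "card {e \<in> ?E. (u \<circ> \<iota>) e = x \<and> v e = y} = 1" if "x \<in> ?L" "y \<in> ?R" for x y
  proof -
    have "{e \<in> ?E. (u \<circ> \<iota>) e = x \<and> v e = y} = {e \<in> ?E. d e = x \<and> v e = y}"
      using \<iota>(3) by (intro Collect_cong conj_cong refl) (simp only: o_apply)
    then show ?thesis using proper[OF that(2,1)] by (simp only: )
  qed
  then have "edge_matrix ?L ?R ?E (u \<circ> \<iota>) v = W ?L ?R"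
    unfolding edge_matrix_def W_def by (intro restrict_ext) (simp only: split_paired_all mem_Sigma_iff split_conv)
  then show ?thesis using \<iota>(1,2) by blast
qed

end
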